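(* Let $n \ge 1$. If $A$ is $n$--cohesive, then $A$ is cohesive relative to $0^{(n-1)}$, i.e. for every set $W$ computably enumerable relative to $0^{(n-1)}$, either $A \subseteq^* W$ or $A \subseteq^* \overline{W}$.
   Context: $[\omega]^n$ is the class of $n$--element subsets of $\omega$. A $2$--coloring $\mathcal{C}:[\omega]^n\to\{0,1\}$ is computably enumerable if one of its color classes is c.e. under a standard coding. $A$ is almost homogeneous for $\mathcal{C}$ if there is a finite $F$ with $\mathcal{C}$ constant on $[A\setminus F]^n$. An infinite set $A$ is $n$--cohesive if it is almost homogeneous for every computably enumerable $2$--coloring of $[\omega]^n$. $X \subseteq^* Y$ means $X \setminus F \subseteq Y$ for some finite $F$; $\overline{W} = \omega\setminus W$; $0^{(k)}$ is the $k$-th jump of $\emptyset$ (with $0^{(0)} = \emptyset$). *)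

theory Defs
  imports Main "HOL-Library.FuncSet" "HOL-Library.Nat_Bijection" "HOL-Library.Ramsey"
begin

text \<open>
  Oracle computability. The distribution has no theory of partial recursive functions, so they are
  set up here in Kleene's style, as unary functions on the natural numbers: several arguments
  are packed into one by the Cantor pairing \<open>prod_encode\<close>. A \<open>prog\<close> is a program
  with access to the characteristic function of an oracle.
\<close>

datatype prog =
    Zero
  | Succ
  | Fst
  | Snd
  | Oracle
  | Pair prog prog
  | Comp prog prog
  | Prec prog prog
  | Mu prog

text \<open>
  \<open>run X p\<close> is the partial function computed by \<open>p\<close> with oracle \<open>X\<close>; \<open>None\<close> means divergence.
  In \<open>Prec f g\<close> the input is a pair of a parameter \<open>a\<close> and a recursion argument \<open>n\<close>, and the step
  function \<open>g\<close> receives \<open>a\<close>, the current index and the previous value. \<open>Mu f\<close> is unbounded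
  search: it diverges if \<open>f\<close> diverges before its first zero is reached.
\<close>

primrec run :: "nat set \<Rightarrow> prog \<Rightarrow> nat \<Rightarrow> nat option" where
  "run X Zero = (\<lambda>x. Some 0)"
| "run X Succ = (\<lambda>x. Some (Suc x))"
| "run X Fst = (\<lambda>x. Some (fst (prod_decode x)))"
| "run X Snd = (\<lambda>x. Some (snd (prod_decode x)))"
| "run X Oracle = (\<lambda>x. Some (if x \<in> X then 1 else 0))"
| "run X (Pair f g) = (\<lambda>x. Option.bind (run X f x) (\<lambda>u.
      Option.bind (run X g x) (\<lambda>v. Some (prod_encode (u, v)))))"
| "run X (Comp f g) = (\<lambda>x. Option.bind (run X g x) (run X f))"
| "run X (Prec f g) = (\<lambda>x. let (a, n) = prod_decode x in
      rec_nat (run X f a)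
        (\<lambda>k r. Option.bind r (\<lambda>v. run X g (prod_encode (a, prod_encode (k, v))))) n)"
| "run X (Mu f) = (\<lambda>a.
      let Q = (\<lambda>n. run X f (prod_encode (a, n)) = Some 0 \<and>
                   (\<forall>m<n. \<exists>k. run X f (prod_encode (a, m)) = Some (Suc k)))
      in if \<exists>n. Q n then Some (THE n. Q n) else None)"

definition ce_in :: "nat set \<Rightarrow> nat set \<Rightarrow> bool" where
  "ce_in X W \<longleftrightarrow> (\<exists>p. W = dom (run X p))"

abbreviation ce :: "nat set \<Rightarrow> bool" where
  "ce W \<equiv> ce_in {} W"

text \<open>
  An explicit, effective numbering of programs. It is injective, with computable range but not
  surjective; numbers outside its range index the nowhere defined function and hence never belong
  to a jump.
\<close>

primrec godel :: "prog \<Rightarrow> nat" where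
  "godel Zero = prod_encode (0, 0)"
| "godel Succ = prod_encode (1, 0)"
| "godel Fst = prod_encode (2, 0)"
| "godel Snd = prod_encode (3, 0)"
| "godel Oracle = prod_encode (4, 0)"
| "godel (Pair f g) = prod_encode (5, prod_encode (godel f, godel g))"
| "godel (Comp f g) = prod_encode (6, prod_encode (godel f, godel g))"
| "godel (Prec f g) = prod_encode (7, prod_encode (godel f, godel g))"
| "godel (Mu f) = prod_encode (8, godel f)"

lemma inj_godel: "inj godel"
proof (rule injI)
  fix p q :: prog
  show "godel p = godel q \<Longrightarrow> p = q"
    by (induction p arbitrary: q) (case_tac q; simp)+
qed

definition jump :: "nat set \<Rightarrow> nat set" where
  "jump X = {godel p | p. godel p \<in> dom (run X p)}"

definition zero_jump :: "nat \<Rightarrow> nat set" where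
  "zero_jump k = (jump ^^ k) {}"

definition almost_subset :: "nat set \<Rightarrow> nat set \<Rightarrow> bool" where
  "almost_subset A B \<longleftrightarrow> (\<exists>F. finite F \<and> A - F \<subseteq> B)"

definition cohesive_rel :: "nat set \<Rightarrow> nat set \<Rightarrow> bool" where
  "cohesive_rel X A \<longleftrightarrow> infinite A \<and>
     (\<forall>W. ce_in X W \<longrightarrow> almost_subset A W \<or> almost_subset A (- W))"

text \<open>
  \<open>nsets UNIV n\<close> is the class of \<open>n\<close>-element subsets of the natural numbers. Finite sets are coded by
  their canonical index \<open>set_encode F\<close>, the sum of the \<open>2 ^ x\<close> for \<open>x\<close> in \<open>F\<close>. Values of a colouring
  off \<open>nsets UNIV n\<close> are never used.
\<close>

definition ce_colouring :: "nat \<Rightarrow> (nat set \<Rightarrow> nat) \<Rightarrow> bool" where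
  "ce_colouring n C \<longleftrightarrow> C \<in> nsets UNIV n \<rightarrow> {0, 1} \<and>
     (\<exists>i\<in>{0, 1}. ce (set_encode ` {S \<in> nsets UNIV n. C S = i}))"

definition almost_homogeneous :: "nat \<Rightarrow> (nat set \<Rightarrow> nat) \<Rightarrow> nat set \<Rightarrow> bool" where
  "almost_homogeneous n C A \<longleftrightarrow> (\<exists>F. finite F \<and> (\<exists>i. \<forall>S \<in> nsets (A - F) n. C S = i))"

definition n_cohesive :: "nat \<Rightarrow> nat set \<Rightarrow> bool" where
  "n_cohesive n A \<longleftrightarrow> infinite A \<and> (\<forall>C. ce_colouring n C \<longrightarrow> almost_homogeneous n C A)"

end

theory Submission imports Defs begin

text \<open>
  If \<open>W\<close> is c.e. in \<open>jump X\<close>, there is a set \<open>D\<close> that is c.e. in \<open>X\<close> such that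
  \<open>(z, s) \<in> D\<close> holds for almost all \<open>s\<close> if \<open>z \<notin> W\<close> and for almost no \<open>s\<close> if \<open>z \<in> W\<close>: every
  potential halting computation coded below \<open>s\<close> is refuted by the enumeration of \<open>jump X\<close>.
  Iterating this \<open>n - 1\<close> times turns a set \<open>W\<close> c.e. in the \<open>(n - 1)\<close>-st jump into a c.e. set of
  increasing \<open>n\<close>-tuples, that is, a c.e. colouring of \<open>n\<close>-element sets whose iterated limit in all
  but the first argument is \<open>W\<close> up to complement. As \<open>A\<close> is infinite, the limits can be taken
  inside \<open>A\<close>, so almost homogeneity for the colouring passes down to \<open>W\<close>.
\<close>

section \<open>Total recursive functions and decidable predicates\<close>

abbreviation pfst :: "nat \<Rightarrow> nat" where "pfst x \<equiv> fst (prod_decode x)"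
abbreviation psnd :: "nat \<Rightarrow> nat" where "psnd x \<equiv> snd (prod_decode x)"
abbreviation npair :: "nat \<Rightarrow> nat \<Rightarrow> nat" where "npair a b \<equiv> prod_encode (a, b)"

definition recf :: "nat set \<Rightarrow> (nat \<Rightarrow> nat) \<Rightarrow> bool" where
  "recf X f \<longleftrightarrow> (\<exists>p. \<forall>x. run X p x = Some (f x))"

definition decf :: "nat set \<Rightarrow> (nat \<Rightarrow> bool) \<Rightarrow> bool" where
  "decf X P \<longleftrightarrow> recf X (\<lambda>x. if P x then 1 else 0)"

lemma recfI: "(\<And>x. run X p x = Some (f x)) \<Longrightarrow> recf X f"
  unfolding recf_def by blast

lemma recf_comp:
  assumes "recf X f" "recf X g" shows "recf X (\<lambda>x. f (g x))"
proof -
  obtain p q where "\<And>x. run X p x = Some (f x)" "\<And>x. run X q x = Some (g x)"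
    using assms unfolding recf_def by blast
  then show ?thesis by (intro recfI[of _ "Comp p q"]) simp
qed

lemma recf_id: "recf X (\<lambda>x. x)"
  by (rule recfI[of _ "Pair Fst Snd"]) simp

lemma recf_Suc: "recf X f \<Longrightarrow> recf X (\<lambda>x. Suc (f x))"
  by (rule recf_comp[of _ Suc]) (auto intro: recfI[of _ Succ])

lemma recf_pfst: "recf X f \<Longrightarrow> recf X (\<lambda>x. pfst (f x))"
  by (rule recf_comp[of _ pfst]) (auto intro: recfI[of _ Fst])

lemma recf_psnd: "recf X f \<Longrightarrow> recf X (\<lambda>x. psnd (f x))"
  by (rule recf_comp[of _ psnd]) (auto intro: recfI[of _ Snd])

lemma recf_const: "recf X (\<lambda>x. c)"
proof (induction c)
  case 0 show ?case by (rule recfI[of _ Zero]) simp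
qed (rule recf_Suc)

lemma recf_npair:
  assumes "recf X f" "recf X g" shows "recf X (\<lambda>x. npair (f x) (g x))"
proof -
  obtain p q where "\<And>x. run X p x = Some (f x)" "\<And>x. run X q x = Some (g x)"
    using assms unfolding recf_def by blast
  then show ?thesis by (intro recfI[of _ "Pair p q"]) simp
qed

lemma recf_rec_nat:
  assumes "recf X b" "recf X n" "recf X (\<lambda>y. h (pfst y) (pfst (psnd y)) (psnd (psnd y)))"
  shows "recf X (\<lambda>x. rec_nat (b x) (h x) (n x))"
proof -
  obtain p q where p: "\<And>x. run X p x = Some (b x)"
    and q: "\<And>y. run X q y = Some (h (pfst y) (pfst (psnd y)) (psnd (psnd y)))"
    using assms unfolding recf_def by blast
  have "run X (Prec p q) (npair x m) = Some (rec_nat (b x) (h x) m)" for x m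
    by (induction m) (simp_all add: p q)
  then have "recf X (\<lambda>y. rec_nat (b (pfst y)) (h (pfst y)) (psnd y))"
    by (intro recfI[of _ "Prec p q"]) (metis prod.collapse prod_decode_inverse)
  from recf_comp[OF this recf_npair[OF recf_id assms(2)]] show ?thesis by simp
qed

lemmas recf_intros = recf_const recf_id recf_Suc recf_pfst recf_psnd recf_npair

lemma recf_add:
  assumes "recf X f" "recf X g" shows "recf X (\<lambda>x. f x + g x)"
proof -
  have "rec_nat (f x) (\<lambda>_ v. Suc v) m = f x + m" for x m by (induction m) auto
  moreover have "recf X (\<lambda>x. rec_nat (f x) (\<lambda>_ v. Suc v) (g x))"
    by (intro recf_rec_nat recf_intros assms)
  ultimately show ?thesis by simp
qed

lemma recf_mult:
  assumes "recf X f" "recf X g" shows "recf X (\<lambda>x. f x * g x)"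
proof -
  have "rec_nat 0 (\<lambda>_ v. f x + v) m = f x * m" for x m by (induction m) auto
  moreover have "recf X (\<lambda>x. rec_nat 0 (\<lambda>_ v. f x + v) (g x))"
    by (intro recf_rec_nat recf_add recf_intros assms recf_comp[OF assms(1)])
  ultimately show ?thesis by simp
qed

lemma recf_power:
  assumes "recf X f" "recf X g" shows "recf X (\<lambda>x. f x ^ g x)"
proof -
  have "rec_nat 1 (\<lambda>_ v. f x * v) m = f x ^ m" for x m by (induction m) auto
  moreover have "recf X (\<lambda>x. rec_nat 1 (\<lambda>_ v. f x * v) (g x))"
    by (intro recf_rec_nat recf_mult recf_intros assms recf_comp[OF assms(1)])
  ultimately show ?thesis by simp
qed

lemma recf_diff:
  assumes "recf X f" "recf X g" shows "recf X (\<lambda>x. f x - g x)"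
proof -
  have pred: "rec_nat 0 (\<lambda>k _. k) m = m - 1" for m by (cases m) auto
  have "rec_nat (f x) (\<lambda>_ v. rec_nat 0 (\<lambda>k _. k) v) m = f x - m" for x m
    by (induction m) (auto simp: pred)
  moreover have "recf X (\<lambda>x. rec_nat (f x) (\<lambda>_ v. rec_nat 0 (\<lambda>k _. k) v) (g x))"
    by (intro recf_rec_nat recf_intros assms)
  ultimately show ?thesis by simp
qed

lemma decf_comp: "decf X P \<Longrightarrow> recf X f \<Longrightarrow> decf X (\<lambda>x. P (f x))"
  unfolding decf_def by (rule recf_comp)

lemma decf_oracle: "recf X f \<Longrightarrow> decf X (\<lambda>x. f x \<in> X)"
  by (rule decf_comp[of X "\<lambda>x. x \<in> X"]) (simp_all add: decf_def recfI[of X Oracle])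

lemma decf_not:
  assumes "decf X P" shows "decf X (\<lambda>x. \<not> P x)"
proof -
  have "recf X (\<lambda>x. 1 - (if P x then 1 else 0))"
    using assms unfolding decf_def by (intro recf_diff recf_intros)
  moreover have "(\<lambda>x. 1 - (if P x then 1 else 0)) = (\<lambda>x. if \<not> P x then 1 else (0::nat))"
    by auto
  ultimately show ?thesis unfolding decf_def by simp
qed

lemma decf_conj:
  assumes "decf X P" "decf X Q" shows "decf X (\<lambda>x. P x \<and> Q x)"
proof -
  have "recf X (\<lambda>x. (if P x then 1 else 0) * (if Q x then 1 else 0))"
    using assms unfolding decf_def by (intro recf_mult)
  moreover have "(\<lambda>x. (if P x then 1 else 0) * (if Q x then 1 else 0)) =
      (\<lambda>x. if P x \<and> Q x then 1 else (0::nat))"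
    by auto
  ultimately show ?thesis unfolding decf_def by simp
qed

lemma decf_disj:
  assumes "decf X P" "decf X Q" shows "decf X (\<lambda>x. P x \<or> Q x)"
  using decf_not[OF decf_conj[OF assms[THEN decf_not]]] by simp

lemma decf_imp:
  assumes "decf X P" "decf X Q" shows "decf X (\<lambda>x. P x \<longrightarrow> Q x)"
  using decf_disj[OF decf_not[OF assms(1)] assms(2)] by (simp only: imp_conv_disj)

lemma decf_le:
  assumes "recf X f" "recf X g" shows "decf X (\<lambda>x. f x \<le> g x)"
proof -
  have "recf X (\<lambda>x. 1 - (f x - g x))"
    by (intro recf_diff recf_intros assms)
  moreover have "(\<lambda>x. 1 - (f x - g x)) = (\<lambda>x. if f x \<le> g x then 1 else 0)" by auto
  ultimately show ?thesis unfolding decf_def by simp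
qed

lemma decf_less: "recf X f \<Longrightarrow> recf X g \<Longrightarrow> decf X (\<lambda>x. f x < g x)"
  using decf_le[of X "\<lambda>x. Suc (f x)" g] by (simp add: recf_Suc Suc_le_eq)

lemma decf_eq:
  assumes "recf X f" "recf X g" shows "decf X (\<lambda>x. f x = g x)"
  using decf_conj[OF decf_le[OF assms] decf_le[OF assms(2,1)]] by (simp only: order.eq_iff[where 'a = nat])

lemma decf_ex:
  assumes "recf X b" "decf X (\<lambda>y. P (pfst y) (psnd y))"
  shows "decf X (\<lambda>x. \<exists>k<b x. P x k)"
proof -
  let ?h = "\<lambda>x k v. 1 - (1 - v) * (1 - (if P x k then 1 else 0 :: nat))"
  have eq: "rec_nat 0 (?h x) m = (if \<exists>k<m. P x k then 1 else 0)" for x m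
    by (induction m) (auto simp: less_Suc_eq)
  have "decf X (\<lambda>y. P (pfst y) (pfst (psnd y)))"
    using decf_comp[OF assms(2), of "\<lambda>y. npair (pfst y) (pfst (psnd y))"]
    by (simp add: recf_intros)
  then have "recf X (\<lambda>x. rec_nat 0 (?h x) (b x))"
    unfolding decf_def by (intro recf_rec_nat recf_diff recf_mult recf_intros assms)
  then show ?thesis unfolding decf_def eq .
qed

lemma decf_all:
  assumes "recf X b" "decf X (\<lambda>y. P (pfst y) (psnd y))"
  shows "decf X (\<lambda>x. \<forall>k<b x. P x k)"
  using decf_not[OF decf_ex[OF assms(1) decf_not[OF assms(2)]]] by simp

lemma mem_set_decode_iff:
  "a \<in> set_decode m \<longleftrightarrow> (\<exists>q<Suc m. \<exists>r<2 ^ a. m = (2 * q + 1) * 2 ^ a + r)"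
proof
  assume "a \<in> set_decode m"
  then have "odd (m div 2 ^ a)" by (simp add: set_decode_def)
  then obtain q where q: "m div 2 ^ a = 2 * q + 1" by (rule oddE)
  have "m = (2 * q + 1) * 2 ^ a + m mod 2 ^ a" by (metis q div_mult_mod_eq)
  moreover have "q \<le> m"
    using q div_le_dividend[of m "2 ^ a"] by linarith
  ultimately show "\<exists>q<Suc m. \<exists>r<2 ^ a. m = (2 * q + 1) * 2 ^ a + r"
    by (metis less_Suc_eq_le mod_less_divisor zero_less_power zero_less_numeral)
next
  assume "\<exists>q<Suc m. \<exists>r<2 ^ a. m = (2 * q + 1) * 2 ^ a + r"
  then obtain q r where "r < 2 ^ a" "m = (2 * q + 1) * 2 ^ a + r" by blast
  then have "m div 2 ^ a = 2 * q + 1"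
    by (metis div_less div_mult_self3 less_nat_zero_code add.right_neutral gr0I mult.commute)
  then show "a \<in> set_decode m" by (simp add: set_decode_def)
qed

lemma decf_set_decode:
  assumes "recf X f" "recf X g" shows "decf X (\<lambda>x. f x \<in> set_decode (g x))"
  unfolding mem_set_decode_iff
  by (intro decf_ex decf_eq recf_add recf_mult recf_power recf_intros assms
      recf_comp[OF assms(1)] recf_comp[OF assms(2)])

lemmas decf_intros = decf_not decf_conj decf_disj decf_imp decf_le decf_less decf_eq decf_ex
  decf_all decf_set_decode recf_intros recf_add recf_mult recf_power

lemma ce_in_exI:
  assumes "decf X R" shows "ce_in X {x. \<exists>y. R (npair x y)}"
proof -
  obtain p where p: "\<And>x. run X p x = Some (if \<not> R x then 1 else 0)"
    using decf_not[OF assms] unfolding decf_def recf_def by blast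
  have "run X p z = Some 0 \<longleftrightarrow> R z" "(\<exists>k. run X p z = Some (Suc k)) \<longleftrightarrow> \<not> R z" for z
    by (simp_all add: p)
  then have "run X (Mu p) x \<noteq> None \<longleftrightarrow> (\<exists>n. R (npair x n) \<and> (\<forall>m<n. \<not> R (npair x m)))" for x
    by (simp only: run.simps Let_def split: if_split) simp
  then have "{x. \<exists>y. R (npair x y)} = dom (run X (Mu p))"
    by (simp add: dom_def del: run.simps flip: exists_least_iff)
  then show ?thesis unfolding ce_in_def by blast
qed

section \<open>Evaluation by finite certificates\<close>

abbreviation triple :: "nat \<Rightarrow> nat \<Rightarrow> nat \<Rightarrow> nat" where
  "triple e x v \<equiv> npair e (npair x v)"

text \<open>A triple \<open>(e, x, v)\<close> asserts that program number \<open>e\<close> maps \<open>x\<close> to \<open>v\<close>. Oracle answers are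
  left open here; \<open>agrees\<close> constrains them.\<close>

definition just :: "nat set \<Rightarrow> nat \<Rightarrow> nat \<Rightarrow> nat \<Rightarrow> bool" where
  "just M e x v \<longleftrightarrow>
     (e = npair 0 0 \<and> v = 0) \<or> (e = npair 1 0 \<and> v = Suc x) \<or>
     (e = npair 2 0 \<and> v = pfst x) \<or> (e = npair 3 0 \<and> v = psnd x) \<or>
     (e = npair 4 0 \<and> v \<le> 1) \<or>
     (pfst e = 5 \<and> triple (pfst (psnd e)) x (pfst v) \<in> M \<and> triple (psnd (psnd e)) x (psnd v) \<in> M) \<or>
     (pfst e = 6 \<and> (\<exists>u. triple (psnd (psnd e)) x u \<in> M \<and> triple (pfst (psnd e)) u v \<in> M)) \<or>
     (pfst e = 7 \<and> psnd x = 0 \<and> triple (pfst (psnd e)) (pfst x) v \<in> M) \<or>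
     (pfst e = 7 \<and> (\<exists>k r. psnd x = Suc k \<and> triple e (npair (pfst x) k) r \<in> M \<and>
         triple (psnd (psnd e)) (npair (pfst x) (npair k r)) v \<in> M)) \<or>
     (pfst e = 8 \<and> triple (psnd e) (npair x v) 0 \<in> M \<and>
         (\<forall>k<v. \<exists>w. triple (psnd e) (npair x k) (Suc w) \<in> M))"

definition valid :: "nat set \<Rightarrow> bool" where
  "valid M \<longleftrightarrow> (\<forall>e x v. triple e x v \<in> M \<longrightarrow> just M e x v)"

definition agrees :: "nat set \<Rightarrow> nat set \<Rightarrow> bool" where
  "agrees Y M \<longleftrightarrow> (\<forall>q. triple (npair 4 0) q 1 \<in> M \<longrightarrow> q \<in> Y) \<and>
                 (\<forall>q. triple (npair 4 0) q 0 \<in> M \<longrightarrow> q \<notin> Y)"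

lemma just_mono: "just M e x v \<Longrightarrow> M \<subseteq> N \<Longrightarrow> just N e x v"
  unfolding just_def by (elim disjE) (simp; blast)+

text \<open>A triple rests only on triples about subprograms or, for primitive recursion, about a smaller
  recursion argument; so no well-foundedness has to be imposed on certificates.\<close>

lemma run_if_valid:
  assumes "valid M" "agrees Y M"
  shows "triple (godel p) x v \<in> M \<Longrightarrow> run Y p x = Some v"
proof (induction p arbitrary: x v)
  case Oracle
  then have "just M (godel Oracle) x v" using assms(1) unfolding valid_def by blast
  then have "v = 0 \<or> v = 1" by (auto simp: just_def)
  then show ?case using Oracle assms(2) by (auto simp: agrees_def)
next
  case (Pair f g)
  from Pair.prems have "just M (godel (Pair f g)) x v" using assms(1) unfolding valid_def by blast
  then show ?case using Pair.IH by (auto simp: just_def)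
next
  case (Comp f g)
  from Comp.prems have "just M (godel (Comp f g)) x v" using assms(1) unfolding valid_def by blast
  then show ?case using Comp.IH by (auto simp add: just_def)
next
  case (Prec f g)
  have "triple (godel (Prec f g)) (npair a n) v \<in> M \<Longrightarrow>
      run Y (Prec f g) (npair a n) = Some v" for a n v
  proof (induction n arbitrary: v)
    case 0
    then have "just M (godel (Prec f g)) (npair a 0) v" using assms(1) unfolding valid_def by blast
    then show ?case using Prec.IH by (simp add: just_def)
  next
    case (Suc n)
    then have "just M (godel (Prec f g)) (npair a (Suc n)) v"
      using assms(1) unfolding valid_def by blast
    then obtain r where "triple (godel (Prec f g)) (npair a n) r \<in> M"
      "triple (godel g) (npair a (npair n r)) v \<in> M"
      by (auto simp: just_def)
    then show ?case using Prec.IH(2) Suc.IH by simp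
  qed
  from this[of "pfst x" "psnd x"] show ?case using Prec.prems by simp
next
  case (Mu f)
  from Mu.prems have "just M (godel (Mu f)) x v" using assms(1) unfolding valid_def by blast
  then have v: "run Y f (npair x v) = Some 0"
    and less: "\<forall>k<v. \<exists>w. run Y f (npair x k) = Some (Suc w)"
    using Mu.IH by (simp_all add: just_def) blast
  have "n = v" if "run Y f (npair x n) = Some 0"
    "\<forall>k<n. \<exists>w. run Y f (npair x k) = Some (Suc w)" for n
    using that v less by (cases n v rule: linorder_cases) auto
  then have "(THE n. run Y f (npair x n) = Some 0 \<and>
      (\<forall>k<n. \<exists>w. run Y f (npair x k) = Some (Suc w))) = v"
    using v less by (intro the_equality) blast+
  then show ?case using v less by (auto simp: Let_def)
next
  case Zero
  then have "just M (godel Zero) x v" using assms(1) unfolding valid_def by blast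
  then show ?case by (simp add: just_def)
next
  case Succ
  then have "just M (godel Succ) x v" using assms(1) unfolding valid_def by blast
  then show ?case by (simp add: just_def)
next
  case Fst
  then have "just M (godel Fst) x v" using assms(1) unfolding valid_def by blast
  then show ?case by (simp add: just_def)
next
  case Snd
  then have "just M (godel Snd) x v" using assms(1) unfolding valid_def by blast
  then show ?case by (simp add: just_def)
qed

definition certified :: "nat set \<Rightarrow> nat \<Rightarrow> bool" where
  "certified Y t \<longleftrightarrow> (\<exists>M. finite M \<and> valid M \<and> agrees Y M \<and> t \<in> M)"

lemma certified_finite:
  assumes "finite T" "\<forall>t\<in>T. certified Y t"
  shows "\<exists>M. finite M \<and> valid M \<and> agrees Y M \<and> T \<subseteq> M"
  using assms
proof (induction T)
  case empty
  show ?case by (rule exI[of _ "{}"]) (auto simp: valid_def agrees_def)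
next
  case (insert t T)
  then obtain M where M: "finite M" "valid M" "agrees Y M" "T \<subseteq> M" by auto
  obtain N where N: "finite N" "valid N" "agrees Y N" "t \<in> N"
    using insert.prems unfolding certified_def by blast
  have "valid (M \<union> N)" using M(2) N(2) unfolding valid_def by (blast intro: just_mono)
  moreover have "agrees Y (M \<union> N)" using M(3) N(3) unfolding agrees_def by blast
  ultimately show ?case using M N by (intro exI[of _ "M \<union> N"]) auto
qed

lemma certifiedI:
  assumes "just T e x v" "finite T" "\<forall>t\<in>T. certified Y t"
    and "e = npair 4 0 \<Longrightarrow> v = (if x \<in> Y then 1 else 0)"
  shows "certified Y (triple e x v)"
proof -
  obtain M where M: "finite M" "valid M" "agrees Y M" "T \<subseteq> M"
    using certified_finite[OF assms(2,3)] by blast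
  let ?N = "insert (triple e x v) M"
  have "valid ?N" unfolding valid_def
  proof (intro allI impI)
    fix e' x' v' assume "triple e' x' v' \<in> ?N"
    then consider "e' = e" "x' = x" "v' = v" | "triple e' x' v' \<in> M"
      by (auto simp: prod_encode_eq)
    then have "just M e' x' v'"
    proof cases
      case 1
      then show ?thesis using just_mono[OF assms(1) M(4)] by (simp only:)
    next
      case 2
      then show ?thesis using M(2) unfolding valid_def by blast
    qed
    then show "just ?N e' x' v'" by (rule just_mono) blast
  qed
  have *: "triple (npair 4 0) q w \<in> M \<or> w = (if q \<in> Y then 1 else 0)"
    if "triple (npair 4 0) q w \<in> ?N" for q w
    using that assms(4) by (simp only: insert_iff prod_encode_eq prod.inject) metis
  have "agrees Y ?N"
    unfolding agrees_def
  proof (intro conjI allI impI)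
    show "q \<in> Y" if "triple (npair 4 0) q 1 \<in> ?N" for q
      using *[OF that] M(3) by (simp add: agrees_def split: if_splits)
    show "q \<notin> Y" if "triple (npair 4 0) q 0 \<in> ?N" for q
      using *[OF that] M(3) by (simp add: agrees_def split: if_splits)
  qed
  with \<open>valid ?N\<close> show ?thesis unfolding certified_def using M(1) by (intro exI[of _ ?N]) simp
qed

lemma certified_if_run: "run Y p x = Some v \<Longrightarrow> certified Y (triple (godel p) x v)"
proof (induction p arbitrary: x v)
  case (Pair f g)
  then obtain u w where "run Y f x = Some u" "run Y g x = Some w" "v = npair u w"
    by (auto simp: bind_eq_Some_conv)
  then show ?case using Pair.IH
    by (intro certifiedI[of "{triple (godel f) x u, triple (godel g) x w}"]) (auto simp: just_def)
next
  case (Comp f g)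
  then obtain u where "run Y g x = Some u" "run Y f u = Some v"
    by (auto simp: bind_eq_Some_conv)
  then show ?case using Comp.IH
    by (intro certifiedI[of "{triple (godel g) x u, triple (godel f) u v}"]) (auto simp: just_def)
next
  case (Prec f g)
  have "run Y (Prec f g) (npair a n) = Some v \<Longrightarrow>
      certified Y (triple (godel (Prec f g)) (npair a n) v)" for a n v
  proof (induction n arbitrary: v)
    case 0
    then have "run Y f a = Some v" by simp
    then show ?case using Prec.IH(1)
      by (intro certifiedI[of "{triple (godel f) a v}"]) (auto simp: just_def)
  next
    case (Suc n)
    then obtain r where "run Y (Prec f g) (npair a n) = Some r"
      "run Y g (npair a (npair n r)) = Some v"
      by (auto simp: bind_eq_Some_conv)
    then show ?case using Prec.IH(2) Suc.IH
      by (intro certifiedI[of "{triple (godel (Prec f g)) (npair a n) r,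
            triple (godel g) (npair a (npair n r)) v}"]) (auto simp: just_def)
  qed
  from this[of "pfst x" "psnd x"] show ?case using Prec.prems by simp
next
  case (Mu f)
  let ?Q = "\<lambda>n. run Y f (npair x n) = Some 0 \<and> (\<forall>m<n. \<exists>k. run Y f (npair x m) = Some (Suc k))"
  have ex: "\<exists>n. ?Q n" and v: "v = (THE n. ?Q n)"
    using Mu.prems by (auto simp: Let_def split: if_splits)
  then obtain n where n: "?Q n" by blast
  have "m = n" if "?Q m" for m
    using that n by (cases m n rule: linorder_cases) auto
  then have "v = n" using n unfolding v by (intro the_equality) blast+
  with n have *: "run Y f (npair x v) = Some 0"
    and "\<forall>m<v. \<exists>k. run Y f (npair x m) = Some (Suc k)" by auto
  then obtain w where w: "\<And>m. m < v \<Longrightarrow> run Y f (npair x m) = Some (Suc (w m))" by metis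
  let ?T = "insert (triple (godel f) (npair x v) 0)
      ((\<lambda>m. triple (godel f) (npair x m) (Suc (w m))) ` {..<v})"
  have "just ?T (godel (Mu f)) x v" by (auto simp: just_def)
  moreover have "\<forall>t\<in>?T. certified Y t" using Mu.IH * w by auto
  ultimately show ?case by (intro certifiedI[of ?T]) auto
qed (rule certifiedI[of "{}"]; auto simp: just_def)+

lemma set_decode_less: "t \<in> set_decode m \<Longrightarrow> t < m"
  using less_exp[of t] by (auto simp: mem_set_decode_iff simp del: less_exp)

lemma triple_less:
  assumes "triple e x v \<in> set_decode m" shows "v < m" "x < m"
  using set_decode_less[OF assms] le_prod_encode_2[of "npair x v" e]
    le_prod_encode_2[of v x] le_prod_encode_1[of x v] by linarith+

lemma just_set_decode:
  "just (set_decode m) e x v \<longleftrightarrow>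
     (e = npair 0 0 \<and> v = 0) \<or> (e = npair 1 0 \<and> v = Suc x) \<or>
     (e = npair 2 0 \<and> v = pfst x) \<or> (e = npair 3 0 \<and> v = psnd x) \<or>
     (e = npair 4 0 \<and> v \<le> 1) \<or>
     (pfst e = 5 \<and> triple (pfst (psnd e)) x (pfst v) \<in> set_decode m \<and>
         triple (psnd (psnd e)) x (psnd v) \<in> set_decode m) \<or>
     (pfst e = 6 \<and> (\<exists>u<m. triple (psnd (psnd e)) x u \<in> set_decode m \<and>
         triple (pfst (psnd e)) u v \<in> set_decode m)) \<or>
     (pfst e = 7 \<and> psnd x = 0 \<and> triple (pfst (psnd e)) (pfst x) v \<in> set_decode m) \<or>
     (pfst e = 7 \<and> (\<exists>k<psnd x. \<exists>r<m. psnd x = Suc k \<and> triple e (npair (pfst x) k) r \<in> set_decode m \<and>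
         triple (psnd (psnd e)) (npair (pfst x) (npair k r)) v \<in> set_decode m)) \<or>
     (pfst e = 8 \<and> triple (psnd e) (npair x v) 0 \<in> set_decode m \<and>
         (\<forall>k<v. \<exists>w<m. triple (psnd e) (npair x k) (Suc w) \<in> set_decode m))"
proof -
  have "(\<exists>u. triple a b u \<in> set_decode m \<and> P u) \<longleftrightarrow> (\<exists>u<m. triple a b u \<in> set_decode m \<and> P u)"
    for a b P by (blast dest: triple_less)
  moreover have "(\<exists>k r. psnd x = Suc k \<and> triple a (b k) r \<in> set_decode m \<and> P k r) \<longleftrightarrow>
     (\<exists>k<psnd x. \<exists>r<m. psnd x = Suc k \<and> triple a (b k) r \<in> set_decode m \<and> P k r)"
    for a b P using lessI by (metis triple_less(1))
  moreover have "(\<exists>w. triple a b (Suc w) \<in> set_decode m) \<longleftrightarrow>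
      (\<exists>w<m. triple a b (Suc w) \<in> set_decode m)" for a b
    by (meson Suc_lessD triple_less(1))
  ultimately show ?thesis unfolding just_def by (simp only:)
qed

lemma decf_just: "decf X (\<lambda>y. just (set_decode (pfst y)) (pfst (psnd y))
    (pfst (psnd (psnd y))) (psnd (psnd (psnd y))))"
  unfolding just_set_decode by (intro decf_intros)

lemma decf_valid: "decf X (\<lambda>m. valid (set_decode m))"
proof -
  have "valid (set_decode m) \<longleftrightarrow> (\<forall>t<m. t \<in> set_decode m \<longrightarrow>
      just (set_decode m) (pfst t) (pfst (psnd t)) (psnd (psnd t)))" for m
    unfolding valid_def
    by (metis prod.collapse prod_decode_inverse prod_encode_inverse fst_conv snd_conv set_decode_less)
  then show ?thesis by (simp only:) (intro decf_intros decf_just)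
qed

lemma agrees_set_decode:
  "agrees Y (set_decode m) \<longleftrightarrow>
     (\<forall>q<m. triple (npair 4 0) q 1 \<in> set_decode m \<longrightarrow> q \<in> Y) \<and>
     (\<forall>q<m. triple (npair 4 0) q 0 \<in> set_decode m \<longrightarrow> q \<notin> Y)"
  unfolding agrees_def by (blast dest: triple_less)

lemma decf_agrees: "decf X (\<lambda>m. agrees X (set_decode m))"
  unfolding agrees_set_decode by (intro decf_intros decf_oracle)

definition cert :: "nat \<Rightarrow> nat \<Rightarrow> nat \<Rightarrow> bool" where
  "cert m e x \<longleftrightarrow> valid (set_decode m) \<and> (\<exists>v<m. triple e x v \<in> set_decode m)"

lemma decf_cert: "decf X (\<lambda>y. cert (pfst y) (pfst (psnd y)) (psnd (psnd y)))"
  unfolding cert_def by (intro decf_intros decf_comp[OF decf_valid])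

lemma dom_run_iff: "x \<in> dom (run Y p) \<longleftrightarrow> (\<exists>m. cert m (godel p) x \<and> agrees Y (set_decode m))"
proof
  assume "x \<in> dom (run Y p)"
  then obtain v where "certified Y (triple (godel p) x v)" using certified_if_run by blast
  then obtain M where M: "finite M" "valid M" "agrees Y M" "triple (godel p) x v \<in> M"
    unfolding certified_def by blast
  then have "cert (set_encode M) (godel p) x \<and> agrees Y (set_decode (set_encode M))"
    unfolding cert_def using triple_less(1)[of _ _ _ "set_encode M"] by auto
  then show "\<exists>m. cert m (godel p) x \<and> agrees Y (set_decode m)" ..
next
  assume "\<exists>m. cert m (godel p) x \<and> agrees Y (set_decode m)"
  then show "x \<in> dom (run Y p)" unfolding cert_def by (blast dest: run_if_valid)
qed

lemma ce_in_exE: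
  assumes "ce_in X W"
  obtains R where "decf X R" "\<And>x. x \<in> W \<longleftrightarrow> (\<exists>y. R (npair x y))"
proof -
  obtain p where p: "W = dom (run X p)" using assms unfolding ce_in_def by blast
  let ?R = "\<lambda>z. cert (psnd z) (godel p) (pfst z) \<and> agrees X (set_decode (psnd z))"
  have "decf X (\<lambda>z. cert (psnd z) (godel p) (pfst z))"
    using decf_comp[OF decf_cert, of X "\<lambda>z. npair (psnd z) (npair (godel p) (pfst z))"]
    by (simp add: recf_intros)
  then have "decf X ?R" by (intro decf_intros decf_comp[OF decf_agrees])
  then show thesis by (rule that) (simp add: p dom_run_iff)
qed

text \<open>Triples can have an index outside the range of \<open>godel\<close> (the step of a primitive recursion is
  not consulted at argument 0), hence a separate certificate for indices.\<close>

definition prog_closed :: "nat set \<Rightarrow> bool" where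
  "prog_closed M \<longleftrightarrow> (\<forall>e\<in>M. (pfst e < 5 \<and> psnd e = 0) \<or>
     (5 \<le> pfst e \<and> pfst e < 8 \<and> pfst (psnd e) \<in> M \<and> psnd (psnd e) \<in> M) \<or>
     (pfst e = 8 \<and> psnd e \<in> M))"

lemma decf_prog_closed: "decf X (\<lambda>m. prog_closed (set_decode m))"
proof -
  have "prog_closed (set_decode m) \<longleftrightarrow> (\<forall>e<m. e \<in> set_decode m \<longrightarrow> (pfst e < 5 \<and> psnd e = 0) \<or>
     (5 \<le> pfst e \<and> pfst e < 8 \<and> pfst (psnd e) \<in> set_decode m \<and> psnd (psnd e) \<in> set_decode m) \<or>
     (pfst e = 8 \<and> psnd e \<in> set_decode m))" for m
    unfolding prog_closed_def by (meson set_decode_less)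
  then show ?thesis by (simp only:) (intro decf_intros)
qed

lemma godel_if_prog_closed:
  assumes "prog_closed M" shows "e \<in> M \<Longrightarrow> e \<in> range godel"
proof (induction e rule: less_induct)
  case (less e)
  define t b where "t = pfst e" and "b = psnd e"
  have e: "e = npair t b" by (simp add: t_def b_def)
  have "n \<le> triangle n" for n by (induction n) simp_all
  from this[of "t + b"] have sub: "b < e" if "0 < t" using that by (simp add: e prod_encode_def)
  have "pfst b \<le> b" "psnd b \<le> b"
    using le_prod_encode_1[of "pfst b" "psnd b"] le_prod_encode_2[of "psnd b" "pfst b"] by simp_all
  with sub less.IH have IH: "c \<in> range godel" if "c \<in> M" "0 < t" "c = pfst b \<or> c = psnd b \<or> c = b" for c
    using that by auto
  consider "t < 5" "b = 0" | "5 \<le> t" "t < 8" "pfst b \<in> M" "psnd b \<in> M" | "t = 8" "b \<in> M"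
    using bspec[OF assms[unfolded prog_closed_def] less.prems] unfolding t_def b_def by metis
  then show ?case
  proof cases
    case 1
    then have "t \<in> {0, 1, 2, 3, 4}" by auto
    then have "e \<in> {godel Zero, godel Succ, godel Fst, godel Snd, godel Oracle}"
      using 1 by (auto simp: e)
    then show ?thesis by blast
  next
    case 2
    then obtain f g where "pfst b = godel f" "psnd b = godel g" using IH by (metis rangeE le_0_eq not_gr0 zero_neq_numeral)
    then have "b = npair (godel f) (godel g)" by (metis prod.collapse prod_decode_inverse)
    moreover have "t \<in> {5, 6, 7}" using 2 by auto
    ultimately have "e \<in> {godel (Pair f g), godel (Comp f g), godel (Prec f g)}" by (auto simp: e)
    then show ?thesis by blast
  next
    case 3
    then obtain f where "b = godel f" using IH by auto
    then have "e = godel (Mu f)" using 3 by (simp add: e)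
    then show ?thesis by blast
  qed
qed

lemma prog_closed_Un: "prog_closed M \<Longrightarrow> prog_closed N \<Longrightarrow> prog_closed (M \<union> N)"
  unfolding prog_closed_def by blast

lemma prog_closed_if_godel: "\<exists>M. finite M \<and> prog_closed M \<and> godel p \<in> M"
proof -
  have insert: "prog_closed (insert e M)" if "prog_closed M"
    "(pfst e < 5 \<and> psnd e = 0) \<or>
     (5 \<le> pfst e \<and> pfst e < 8 \<and> pfst (psnd e) \<in> M \<and> psnd (psnd e) \<in> M) \<or>
     (pfst e = 8 \<and> psnd e \<in> M)" for e M
    using that unfolding prog_closed_def by (intro ballI; elim insertE; blast)
  have binary: "\<exists>M. finite M \<and> prog_closed M \<and> npair t (npair a b) \<in> M"
    if "finite M" "prog_closed M" "a \<in> M" "finite N" "prog_closed N" "b \<in> N" "5 \<le> t" "t < 8"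
    for t a b M N
    using that insert[OF prog_closed_Un[of M N], of "npair t (npair a b)"]
    by (intro exI[of _ "insert (npair t (npair a b)) (M \<union> N)"]) simp
  have "prog_closed {}" by (simp add: prog_closed_def)
  from insert[OF this] have leaf: "\<exists>M. finite M \<and> prog_closed M \<and> npair t 0 \<in> M" if "t < 5" for t
    using that by (intro exI[of _ "{npair t 0}"]) simp
  show ?thesis
  proof (induction p)
    case (Pair f g) then show ?case using binary[of _ _ _ _ 5] by auto
  next
    case (Comp f g) then show ?case using binary[of _ _ _ _ 6] by auto
  next
    case (Prec f g) then show ?case using binary[of _ _ _ _ 7] by auto
  next
    case (Mu f)
    then obtain M where "finite M" "prog_closed M" "godel f \<in> M" by blast
    then show ?case using insert[of M "godel (Mu f)"]
      by (intro exI[of _ "insert (godel (Mu f)) M"]) simp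
  qed (simp_all add: leaf)
qed

lemma jump_exE:
  obtains T where "decf X T" "\<And>e. e \<in> jump X \<longleftrightarrow> (\<exists>y. T (npair e y))"
proof -
  let ?T = "\<lambda>z. prog_closed (set_decode (pfst (psnd z))) \<and> pfst z \<in> set_decode (pfst (psnd z)) \<and>
      cert (psnd (psnd z)) (pfst z) (pfst z) \<and> agrees X (set_decode (psnd (psnd z)))"
  have "decf X (\<lambda>z. cert (psnd (psnd z)) (pfst z) (pfst z))"
    using decf_comp[OF decf_cert, of X "\<lambda>z. npair (psnd (psnd z)) (npair (pfst z) (pfst z))"]
    by (simp add: recf_intros)
  then have dec: "decf X ?T"
    by (intro decf_intros decf_comp[OF decf_agrees] decf_comp[OF decf_prog_closed])
  have "e \<in> jump X \<longleftrightarrow> (\<exists>y. ?T (npair e y))" for e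
  proof
    assume "e \<in> jump X"
    then obtain p where p: "e = godel p" "godel p \<in> dom (run X p)" unfolding jump_def by blast
    then obtain m where m: "cert m e e" "agrees X (set_decode m)" unfolding dom_run_iff by blast
    obtain M where "finite M" "prog_closed M" "e \<in> M" using prog_closed_if_godel p(1) by blast
    then have "?T (npair e (npair (set_encode M) m))" using m by simp
    then show "\<exists>y. ?T (npair e y)" ..
  next
    assume "\<exists>y. ?T (npair e y)"
    then obtain y where y: "?T (npair e y)" ..
    then obtain p where p: "e = godel p" using godel_if_prog_closed by fastforce
    moreover have "godel p \<in> dom (run X p)" unfolding dom_run_iff using y by (auto simp: p)
    ultimately show "e \<in> jump X" unfolding jump_def by blast
  qed
  with dec show thesis by (rule that)
qed


section \<open>The limit lemma for sets c.e. in a jump\<close>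

lemma bounded_witnesses:
  assumes "finite I" "\<forall>i\<in>I. \<exists>t. P i t"
  shows "\<exists>B::nat. \<forall>i\<in>I. \<exists>t<B. P i t"
proof -
  obtain f where "\<forall>i\<in>I. P i (f i)" using assms(2) by metis
  moreover have "\<forall>i\<in>I. f i < Suc (Max (f ` I))"
    using assms(1) by (simp add: less_Suc_eq_le)
  ultimately show ?thesis by blast
qed

lemma ce_in_jump_limit:
  assumes "ce_in (jump X) W"
  obtains D where "ce_in X D" "\<And>z. \<exists>s0. \<forall>s\<ge>s0. npair z s \<in> D \<longleftrightarrow> z \<notin> W"
proof -
  obtain p where p: "W = dom (run (jump X) p)" using assms unfolding ce_in_def by blast
  obtain T where T: "decf X T" "\<And>e. e \<in> jump X \<longleftrightarrow> (\<exists>y. T (npair e y))" by (rule jump_exE[of X]) (rule that)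
  define R where "R = (\<lambda>x u. cert (pfst u) (godel p) x \<and>
      (\<forall>q<pfst u. triple (npair 4 0) q 1 \<in> set_decode (pfst u) \<longrightarrow> (\<exists>t<psnd u. T (npair q t))))"
  define N where "N = (\<lambda>u t. \<exists>q<pfst u. triple (npair 4 0) q 0 \<in> set_decode (pfst u) \<and> T (npair q t))"
  have W: "x \<in> W \<longleftrightarrow> (\<exists>u. R x u \<and> (\<forall>t. \<not> N u t))" for x
  proof
    assume "x \<in> W"
    then obtain m where m: "cert m (godel p) x" "agrees (jump X) (set_decode m)"
      unfolding p dom_run_iff by blast
    let ?I = "{q. q < m \<and> triple (npair 4 0) q 1 \<in> set_decode m}"
    have "\<forall>q\<in>?I. \<exists>t. T (npair q t)" using m(2) unfolding agrees_def T(2) by simp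
    with bounded_witnesses[of ?I "\<lambda>q t. T (npair q t)"]
    obtain B where "\<forall>q\<in>?I. \<exists>t<B. T (npair q t)" by auto
    then have "R x (npair m B)" using m(1) by (simp add: R_def)
    moreover have "\<not> N (npair m B) t" for t
      using m(2) unfolding agrees_def T(2) N_def by auto
    ultimately show "\<exists>u. R x u \<and> (\<forall>t. \<not> N u t)" by blast
  next
    assume "\<exists>u. R x u \<and> (\<forall>t. \<not> N u t)"
    then obtain u where u: "R x u" "\<forall>t. \<not> N u t" by blast
    then have "agrees (jump X) (set_decode (pfst u))"
      unfolding agrees_set_decode T(2) R_def N_def by blast
    then show "x \<in> W" using u(1) unfolding p dom_run_iff R_def by blast
  qed
  define M where "M = (\<lambda>z. \<forall>u<psnd (pfst z). \<exists>t<psnd z. \<not> R (pfst (pfst z)) u \<or> N u t)"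
  define D where "D = {y. \<exists>B. M (npair y B)}"
  have D: "npair x s \<in> D \<longleftrightarrow> (\<forall>u<s. \<exists>t. \<not> R x u \<or> N u t)" for x s
  proof
    assume "\<forall>u<s. \<exists>t. \<not> R x u \<or> N u t"
    then have "\<exists>B. \<forall>u\<in>{..<s}. \<exists>t<B. \<not> R x u \<or> N u t"
      by (intro bounded_witnesses) auto
    then show "npair x s \<in> D" by (simp add: D_def M_def Ball_def)
  qed (auto simp: D_def M_def)
  have cert: "decf X (\<lambda>y. cert (f y) (godel p) (g y))" if "recf X f" "recf X g" for f g
    using decf_comp[OF decf_cert, of X "\<lambda>y. npair (f y) (npair (godel p) (g y))"] that
    by (simp add: recf_intros)
  have "decf X M" unfolding M_def R_def N_def
    by (intro decf_intros decf_comp[OF T(1)] cert)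
  then have "ce_in X D" unfolding D_def by (rule ce_in_exI)
  moreover have "\<exists>s0. \<forall>s\<ge>s0. npair z s \<in> D \<longleftrightarrow> z \<notin> W" for z
  proof (cases "z \<in> W")
    case True
    then obtain u where "R z u" "\<forall>t. \<not> N u t" unfolding W by blast
    then have "npair z s \<notin> D" if "s \<ge> Suc u" for s
      using that unfolding D by (auto simp: Suc_le_eq)
    with True show ?thesis by blast
  next
    case False
    then have "npair z s \<in> D" for s unfolding D W by blast
    with False show ?thesis by blast
  qed
  ultimately show thesis by (rule that)
qed

section \<open>Increasing tuples\<close>

text \<open>A tuple \<open>(((x\<^sub>0, x\<^sub>1), \<dots>), x\<^sub>k)\<close> of length \<open>k + 1\<close> is coded by one number \<open>z\<close>; the argument
  \<open>k\<close> is one less than the length.\<close>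

primrec top_elt :: "nat \<Rightarrow> nat \<Rightarrow> nat" where
  "top_elt 0 z = z"
| "top_elt (Suc k) z = psnd z"

primrec increasing :: "nat \<Rightarrow> nat \<Rightarrow> bool" where
  "increasing 0 z \<longleftrightarrow> True"
| "increasing (Suc k) z \<longleftrightarrow> increasing k (pfst z) \<and> top_elt k (pfst z) < psnd z"

primrec elts :: "nat \<Rightarrow> nat \<Rightarrow> nat set" where
  "elts 0 z = {z}"
| "elts (Suc k) z = insert (psnd z) (elts k (pfst z))"

primrec elts_code :: "nat \<Rightarrow> nat \<Rightarrow> nat" where
  "elts_code 0 z = 2 ^ z"
| "elts_code (Suc k) z = 2 ^ psnd z + elts_code k (pfst z)"

lemma finite_elts [simp]: "finite (elts k z)"
  by (induction k arbitrary: z) auto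

lemma top_elt_in: "top_elt k z \<in> elts k z"
  by (cases k) auto

lemma elts_le_top: "increasing k z \<Longrightarrow> y \<in> elts k z \<Longrightarrow> y \<le> top_elt k z"
  by (induction k arbitrary: z) fastforce+

lemma psnd_notin_elts: "increasing (Suc k) z \<Longrightarrow> psnd z \<notin> elts k (pfst z)"
  using elts_le_top[of k "pfst z" "psnd z"] by auto

lemma card_elts: "increasing k z \<Longrightarrow> card (elts k z) = Suc k"
proof (induction k arbitrary: z)
  case (Suc k)
  then show ?case using psnd_notin_elts[OF Suc.prems] by simp
qed simp

lemma set_encode_elts: "increasing k z \<Longrightarrow> set_encode (elts k z) = elts_code k z"
proof (induction k arbitrary: z)
  case (Suc k)
  then show ?case using psnd_notin_elts[OF Suc.prems] by simp
qed simp

lemma elts_inj: "increasing k z \<Longrightarrow> increasing k z' \<Longrightarrow> elts k z = elts k z' \<Longrightarrow> z = z'"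
proof (induction k arbitrary: z z')
  case (Suc k)
  have "top_elt (Suc k) z = top_elt (Suc k) z'"
    using elts_le_top[OF Suc.prems(1)] elts_le_top[OF Suc.prems(2)] top_elt_in Suc.prems(3)
    by (metis order.antisym)
  then have snd: "psnd z = psnd z'" by simp
  then have "elts k (pfst z) = elts k (pfst z')"
    using Suc.prems psnd_notin_elts[OF Suc.prems(1)] psnd_notin_elts[OF Suc.prems(2)]
    by (simp add: insert_ident)
  then have "pfst z = pfst z'" using Suc by simp
  with snd show ?case by (metis prod.collapse prod_decode_inverse)
qed simp

lemma recf_top_elt: "recf X (top_elt k)"
proof (cases k)
  case 0
  then have "top_elt k = (\<lambda>z. z)" by auto
  then show ?thesis by (simp only: recf_id)
next
  case (Suc l)
  then have "top_elt k = (\<lambda>z. psnd z)" by auto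
  then show ?thesis by (simp only: recf_psnd[OF recf_id])
qed

lemma decf_increasing: "decf X (increasing k)"
proof (induction k)
  case 0
  have "decf X (\<lambda>x. 0 = (0::nat))" by (intro decf_intros)
  then show ?case by simp
next
  case (Suc k)
  have "decf X (\<lambda>z. increasing k (pfst z) \<and> top_elt k (pfst z) < psnd z)"
    by (intro decf_intros decf_comp[OF Suc] recf_comp[OF recf_top_elt])
  then show ?case by simp
qed

lemma recf_elts_code: "recf X (elts_code k)"
proof (induction k)
  case 0
  have "recf X (\<lambda>z. 2 ^ z)" by (intro decf_intros)
  then show ?case by simp
next
  case (Suc k)
  have "recf X (\<lambda>z. 2 ^ psnd z + elts_code k (pfst z))"
    by (intro decf_intros recf_comp[OF Suc])
  then show ?case by simp
qed

lemma ce_elts_codes: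
  assumes "ce W"
  shows "ce {m. \<exists>z. z \<in> W \<and> increasing k z \<and> elts_code k z = m}"
proof -
  obtain R where R: "decf {} R" "\<And>x. x \<in> W \<longleftrightarrow> (\<exists>y. R (npair x y))"
    using ce_in_exE[OF assms] by blast
  let ?Q = "\<lambda>w. R (psnd w) \<and> increasing k (pfst (psnd w)) \<and> elts_code k (pfst (psnd w)) = pfst w"
  have "decf {} ?Q"
    by (intro decf_intros decf_comp[OF R(1)] decf_comp[OF decf_increasing]
        recf_comp[OF recf_elts_code])
  then have "ce {m. \<exists>y. ?Q (npair m y)}" by (rule ce_in_exI)
  moreover have "(\<exists>z. z \<in> W \<and> increasing k z \<and> elts_code k z = m) \<longleftrightarrow> (\<exists>y. ?Q (npair m y))" for m
    unfolding R(2) by (simp, metis prod.collapse prod_decode_inverse fst_conv prod_encode_inverse)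
  ultimately show ?thesis by simp
qed

definition tuple_homogeneous :: "nat \<Rightarrow> nat set \<Rightarrow> nat set \<Rightarrow> bool" where
  "tuple_homogeneous k W A \<longleftrightarrow> (\<exists>F b. finite F \<and>
     (\<forall>z. increasing k z \<and> elts k z \<subseteq> A - F \<longrightarrow> (z \<in> W \<longleftrightarrow> b)))"

lemma tuple_homogeneous_ce:
  assumes "n_cohesive (Suc k) A" "ce W"
  shows "tuple_homogeneous k W A"
proof -
  define C where "C = (\<lambda>S. if \<exists>z. z \<in> W \<and> increasing k z \<and> elts k z = S then 1 else 0 :: nat)"
  have "{S \<in> nsets UNIV (Suc k). C S = 1} = {S. \<exists>z. z \<in> W \<and> increasing k z \<and> elts k z = S}"
    by (auto simp: C_def nsets_def card_elts)
  then have "set_encode ` {S \<in> nsets UNIV (Suc k). C S = 1} =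
      {m. \<exists>z. z \<in> W \<and> increasing k z \<and> elts_code k z = m}"
    using set_encode_elts by (simp only: image_def mem_Collect_eq bex_simps) metis
  then have "ce (set_encode ` {S \<in> nsets UNIV (Suc k). C S = 1})"
    using ce_elts_codes[OF assms(2)] by simp
  then have "ce_colouring (Suc k) C"
    unfolding ce_colouring_def by (intro conjI bexI[of _ 1]) (simp_all add: C_def)
  then obtain F i where F: "finite F" "\<forall>S\<in>nsets (A - F) (Suc k). C S = i"
    using assms(1) unfolding n_cohesive_def almost_homogeneous_def by blast
  have "z \<in> W \<longleftrightarrow> i = 1" if z: "increasing k z" "elts k z \<subseteq> A - F" for z
  proof -
    have "C (elts k z) = i" using F(2) z by (auto simp: nsets_def card_elts)
    moreover have "C (elts k z) = 1 \<longleftrightarrow> z \<in> W"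
      using z(1) elts_inj[of k z] unfolding C_def by (metis zero_neq_one)
    ultimately show ?thesis by blast
  qed
  with F(1) show ?thesis unfolding tuple_homogeneous_def by blast
qed

lemma tuple_homogeneous_limit:
  assumes "tuple_homogeneous (Suc k) D A" "infinite A"
    and lim: "\<And>z. \<exists>s0. \<forall>s\<ge>s0. npair z s \<in> D \<longleftrightarrow> z \<notin> W"
  shows "tuple_homogeneous k W A"
proof -
  obtain F b where F: "finite F"
    "\<And>z. increasing (Suc k) z \<Longrightarrow> elts (Suc k) z \<subseteq> A - F \<Longrightarrow> z \<in> D \<longleftrightarrow> b"
    using assms(1) unfolding tuple_homogeneous_def by metis
  have "z \<in> W \<longleftrightarrow> \<not> b" if z: "increasing k z" "elts k z \<subseteq> A - F" for z
  proof -
    obtain s0 where s0: "\<And>s. s \<ge> s0 \<Longrightarrow> npair z s \<in> D \<longleftrightarrow> z \<notin> W" using lim by blast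
    have "infinite (A - F)" using F(1) assms(2) by simp
    then obtain s where s: "s \<in> A - F" "max s0 (top_elt k z) < s"
      by (meson infinite_nat_iff_unbounded)
    then have "increasing (Suc k) (npair z s)" "elts (Suc k) (npair z s) \<subseteq> A - F"
      using z by simp_all
    then have "npair z s \<in> D \<longleftrightarrow> b" by (rule F(2))
    moreover have "npair z s \<in> D \<longleftrightarrow> z \<notin> W" using s(2) by (intro s0) simp
    ultimately show ?thesis by blast
  qed
  with F(1) show ?thesis
    unfolding tuple_homogeneous_def by (intro exI[of _ F] exI[of _ "\<not> b"]) simp
qed

lemma tuple_homogeneous_zero_jump:
  assumes "infinite A"
  shows "ce_in (zero_jump j) W \<Longrightarrow> n_cohesive (Suc (k + j)) A \<Longrightarrow> tuple_homogeneous k W A"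
proof (induction j arbitrary: k W)
  case 0
  then show ?case by (simp add: zero_jump_def tuple_homogeneous_ce)
next
  case (Suc j)
  have "ce_in (jump (zero_jump j)) W" using Suc.prems(1) by (simp add: zero_jump_def)
  then obtain D where D: "ce_in (zero_jump j) D"
    "\<And>z. \<exists>s0. \<forall>s\<ge>s0. npair z s \<in> D \<longleftrightarrow> z \<notin> W"
    by (rule ce_in_jump_limit) blast
  have "tuple_homogeneous (Suc k) D A" using Suc.IH[OF D(1)] Suc.prems(2) by simp
  then show ?case using assms D(2) by (rule tuple_homogeneous_limit)
qed

theorem theorem4p3:
  fixes n :: nat and A :: "nat set"
  assumes "n \<ge> 1" and "n_cohesive n A"
  shows "cohesive_rel (zero_jump (n - 1)) A"
proof -
  have inf: "infinite A" using assms(2) by (simp add: n_cohesive_def)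
  have "almost_subset A W \<or> almost_subset A (- W)" if W: "ce_in (zero_jump (n - 1)) W" for W
  proof -
    have "tuple_homogeneous 0 W A"
      using assms by (intro tuple_homogeneous_zero_jump[OF inf W]) simp
    then have "\<exists>F b. finite F \<and> (\<forall>x. x \<in> A - F \<longrightarrow> (x \<in> W \<longleftrightarrow> b))"
      unfolding tuple_homogeneous_def by simp
    then obtain F b where F: "finite F" "\<And>x. x \<in> A - F \<Longrightarrow> x \<in> W \<longleftrightarrow> b"
      by metis
    show ?thesis
    proof (cases b)
      case True
      then have "A - F \<subseteq> W" using F(2) by blast
      with F(1) show ?thesis unfolding almost_subset_def by blast
    next
      case False
      then have "A - F \<subseteq> - W" using F(2) by blast
      with F(1) show ?thesis unfolding almost_subset_def by blast
    qed
  qed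
  with inf show ?thesis unfolding cohesive_rel_def by simp
qed

end
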